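(* Assume the setting and hypotheses (A.1)–(A.7) described in the context, and let $M(x)=\max_{n\le x}\log f(f(n))$. Then, for sufficiently large $x$, \[ M(x)\le \frac{\sqrt{\log x}}{\log_2 x}\left(\frac{C_g}{\sqrt{\kappa c_\dagger}}+\mathcal{O}\!\left(\frac{\log_3 x}{\log_2 x}\right)\right), \] where the implied constant depends on $Q$ and $f$, and \[ C_g=\left(8\sum_{j=1}^{\infty}\left(\log\frac{g(j)}{g(j-1)}\right)^2\right)^{1/2}. \]
   Context: Setting: let $(q_j)_{j\ge1}$ be a strictly increasing sequence of primes, $Q=\{q_j:j\in\mathbb{N}\}$, and $\langle Q\rangle$ the multiplicative monoid generated by $Q$ (products of elements of $Q$, including $1$). Let $g:\mathbb{N}_0\to\mathbb{N}$ with $g(0)=1$, and $g^{\dagger}(y)=\inf\{x\in\mathbb{N}: g(x)=y\}\in\mathbb{N}\cup\{+\infty\}$. Hypotheses: (A.1) $q_j=\kappa j(\log j+\log\log j+\mathcal{O}(1))$ for some constant $\kappa>0$; (A.2) $g$ is monotonically increasing; (A.3) $g(\mathbb{N})\supseteq\langle Q\rangle$; (A.4) $g^{\dagger}(b)+c_* b\, g^{\dagger}(a)\le g^{\dagger}(ab)$ for all $a,b\in\langle Q\rangle$ with $q_1\le a\le b$, where $c_*>1/q_1$ is a constant; (A.5) $g(i)/g(i-1)=1+\mathcal{O}(i^{-1/2-\epsilon})$ for some $\epsilon>0$; (A.6) $g(x)\le c_f x$ for all $x\in\mathbb{N}$, for some constant $c_f>0$; (A.7) $g^{\dagger}(q)=c_\dagger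 q+\mathcal{O}(q/\log q)$ as $Q\ni q\to\infty$, for some constant $c_\dagger>0$. Let $f$ be a multiplicative arithmetic function with, for every prime power $p^\nu$ with $\nu\ge1$, $f(p^\nu)=g(\nu)$ if $p\in Q$ and $f(p^\nu)\in\{0,1\}$ if $p\notin Q$; also $f(0)=1$. $\log$ is the natural logarithm, $\log_k$ the $k$-fold iterated logarithm, $\log 0=-\infty$, and the maximum is over positive integers $n\le x$. *)

theory Defs
  imports
    "HOL-Analysis.Analysis"
    "HOL-Computational_Algebra.Primes"
    "HOL-Library.Multiset"
    "HOL-Library.Landau_Symbols"
    "HOL-Library.Extended_Nat"
    "HOL-Library.Extended_Real"
begin

definition mult_monoid :: "nat set \<Rightarrow> nat set" where
  "mult_monoid Q = {prod_mset A | A. set_mset A \<subseteq> Q}"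

(* The infimum is over positive x only; it is \<infinity> when g never takes the value y there. *)
definition dagger :: "(nat \<Rightarrow> nat) \<Rightarrow> nat \<Rightarrow> enat" where
  "dagger g y = Inf (enat ` {x. 1 \<le> x \<and> g x = y})"

(* No condition at 0: the value f 0 is fixed separately. *)
definition multiplicative :: "(nat \<Rightarrow> nat) \<Rightarrow> bool" where
  "multiplicative f \<longleftrightarrow>
     f 1 = 1 \<and> (\<forall>m n. 0 < m \<and> 0 < n \<and> coprime m n \<longrightarrow> f (m * n) = f m * f n)"

(* Extended-real logarithm with log 0 = -\<infinity>; the library's ln 0 is 0 instead. *)
definition elog :: "nat \<Rightarrow> ereal" where
  "elog n = (if n = 0 then -\<infinity> else ereal (ln (real n)))"

definition max_log_iter :: "(nat \<Rightarrow> nat) \<Rightarrow> real \<Rightarrow> ereal" where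
  "max_log_iter f x = Max ((\<lambda>n. elog (f (f n))) ` {n. 1 \<le> n \<and> real n \<le> x})"

(* The series over j \<ge> 1 is shifted to start at 0. *)
definition C_const :: "(nat \<Rightarrow> nat) \<Rightarrow> real" where
  "C_const g = sqrt (8 * (\<Sum>j. (ln (real (g (Suc j)) / real (g j)))\<^sup>2))"

end

theory Submission
  imports Defs "HOL-Real_Asymp.Real_Asymp"
begin

text \<open>
  Put \<open>L = ln x\<close> and \<open>T = sqrt L / ln L ^ 3\<close>, and write \<open>H\<close> for the function
  \<open>dagger g\<close>. Since \<open>g\<close> is monotone and (A.4) makes \<open>H\<close> superadditive on the monoid generated
  by \<open>Q\<close>, the exponent \<open>\<nu>\<close> of a prime \<open>p\<close> in \<open>n\<close> is at least the sum of \<open>H r\<close> over the prime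
  factors \<open>r \<in> Q\<close> of \<open>g \<nu>\<close>, counted with multiplicity. The primes \<open>p \<le> T\<close> contribute
  only \<open>O(T * ln L)\<close> prime factors to \<open>f n\<close> and can be ignored; for the others \<open>ln p\<close> is
  essentially \<open>ln L / 2\<close>, so that the exponents \<open>\<alpha> j\<close> of \<open>q j\<close> in \<open>f n\<close> satisfy
  \<open>(\<Sum>j. \<alpha> j * H (q j)) * ln T \<le> L\<close>. If \<open>t i\<close> denotes the number of \<open>j\<close> with \<open>\<alpha> j > i\<close>,
  then \<open>ln (f (f n)) \<le> (\<Sum>i. t i * ln (g (i + 1) / g i))\<close>, while the cost is at least
  \<open>(\<Sum>i. c_dag * \<kappa> / 2 * (t i)\<^sup>2 * ln (t i))\<close> up to lower order terms; the layers with
  \<open>t i \<le> T\<close> are negligible and Cauchy--Schwarz gives the constant for the others.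
\<close>

lemma multiplicative_eq_prod:
  assumes "multiplicative f" "n > 0"
  shows "f n = (\<Prod>p\<in>prime_factors n. f (p ^ multiplicity p n))"
proof -
  have "f (\<Prod>p\<in>A. p ^ e p) = (\<Prod>p\<in>A. f (p ^ e p))"
    if "finite A" "\<forall>p\<in>A. prime p" for A and e :: "nat \<Rightarrow> nat"
    using that
  proof (induction A rule: finite_induct)
    case empty
    then show ?case using assms by (simp add: multiplicative_def)
  next
    case (insert p A)
    have "coprime (p ^ e p) (\<Prod>p\<in>A. p ^ e p)"
      using insert by (intro prod_coprime_right) (auto intro!: primes_coprime)
    moreover have "0 < p ^ e p" "0 < (\<Prod>p\<in>A. p ^ e p)"
      using insert.prems by (auto intro!: prod_pos simp: prime_gt_0_nat)
    ultimately have "f (p ^ e p * (\<Prod>p\<in>A. p ^ e p)) = f (p ^ e p) * f (\<Prod>p\<in>A. p ^ e p)"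
      using assms(1) unfolding multiplicative_def by blast
    then show ?case using insert by simp
  qed
  from this[of "prime_factors n" "\<lambda>p. multiplicity p n"] show ?thesis
    using assms(2) prime_factorization_nat[of n] by (simp add: in_prime_factors_imp_prime)
qed

lemma dagger_eq_Least:
  assumes "y \<in> g ` {1..}"
  shows "dagger g y = enat (LEAST x. 1 \<le> x \<and> g x = y)"
proof -
  let ?P = "\<lambda>x. 1 \<le> x \<and> g x = y"
  have P: "?P (LEAST x. ?P x)" using assms LeastI_ex[of ?P] by auto
  show ?thesis unfolding dagger_def
  proof (rule antisym)
    show "Inf (enat ` {x. ?P x}) \<le> enat (LEAST x. ?P x)"
      using P by (intro Inf_lower imageI CollectI)
    show "enat (LEAST x. ?P x) \<le> Inf (enat ` {x. ?P x})"
    proof (rule Inf_greatest)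
      fix z assume "z \<in> enat ` {x. ?P x}"
      then obtain x where "z = enat x" "?P x" by blast
      then show "enat (LEAST x. ?P x) \<le> z" using Least_le[of ?P x] by simp
    qed
  qed
qed

lemma
  assumes "y \<in> g ` {1..}"
  shows enat_the_enat_dagger: "enat (the_enat (dagger g y)) = dagger g y"
    and the_enat_dagger_ge_1: "1 \<le> the_enat (dagger g y)"
    and apply_the_enat_dagger: "g (the_enat (dagger g y)) = y"
proof -
  let ?P = "\<lambda>x. 1 \<le> x \<and> g x = y"
  have "?P (LEAST x. ?P x)" using assms LeastI_ex[of ?P] by auto
  then show "enat (the_enat (dagger g y)) = dagger g y" "1 \<le> the_enat (dagger g y)"
    "g (the_enat (dagger g y)) = y"
    unfolding dagger_eq_Least[OF assms] the_enat.simps by blast+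
qed

lemma the_enat_dagger_le:
  assumes "mono g" "y \<in> g ` {1..}" "1 \<le> x" "y \<le> g x"
  shows "the_enat (dagger g y) \<le> x"
proof (rule ccontr)
  assume "\<not> ?thesis"
  then have less: "x < the_enat (dagger g y)" by simp
  then have "g x \<le> g (the_enat (dagger g y))" using assms(1) by (simp add: monoD)
  then have "g x = y" using assms apply_the_enat_dagger[OF assms(2)] by simp
  then have "(LEAST x. 1 \<le> x \<and> g x = y) \<le> x" using assms(3) by (intro Least_le) auto
  then show False using less dagger_eq_Least[OF assms(2)] by simp
qed


lemma sum_image_mset_le_superadditive:
  fixes H :: "nat \<Rightarrow> nat"
  assumes super: "\<And>a b. a \<in> mult_monoid Q \<Longrightarrow> b \<in> mult_monoid Q \<Longrightarrow> a \<noteq> 1 \<Longrightarrow> b \<noteq> 1 \<Longrightarrow>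
      H a + H b \<le> H (a * b)"
    and primes: "\<And>r. r \<in> Q \<Longrightarrow> prime r"
    and M: "set_mset M \<subseteq> Q"
  shows "(\<Sum>r\<in>#M. H r) \<le> H (prod_mset M)"
  using M
proof (induction M)
  case (add r M)
  show ?case
  proof (cases "M = {#}")
    case False
    then obtain s where s: "s \<in># M" by blast
    then have "s dvd prod_mset M" "s \<in> Q" using add.prems by (auto intro: dvd_prod_mset)
    then have "prod_mset M \<noteq> 1" using primes[of s] not_prime_unit by fastforce
    moreover have "prod_mset M \<in> mult_monoid Q" "r \<in> mult_monoid Q"
      using add.prems by (auto simp: mult_monoid_def intro: exI[of _ "{#r#}"])
    moreover have "r \<noteq> 1" using primes[of r] add.prems by auto
    ultimately have "H r + H (prod_mset M) \<le> H (r * prod_mset M)" by (intro super) auto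
    then show ?thesis using add by simp
  qed simp
qed simp

lemma sum_le_sum_of_finite_subset:
  fixes h :: "nat \<Rightarrow> real"
  assumes "mono_on {1..} h" "finite S" "S \<subseteq> {1..}"
  shows "(\<Sum>j=1..card S. h j) \<le> (\<Sum>j\<in>S. h j)"
  using assms(2,3)
proof (induction S rule: finite_linorder_max_induct)
  case (insert b A)
  have "b \<notin> A" using insert by auto
  then have card: "card (insert b A) = Suc (card A)" using insert by simp
  have "insert b A \<subseteq> {1..b}" using insert by (force simp: less_imp_le)
  then have "Suc (card A) \<le> b" using card card_mono[of "{1..b}" "insert b A"] by simp
  then have "h (Suc (card A)) \<le> h b" using assms(1) by (auto simp: mono_on_def)
  then show ?case using insert \<open>b \<notin> A\<close> by simp
qed simp

lemma sum_nat_mult_ln_ge: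
  "(real t)\<^sup>2 / 2 * ln (real t) - (real t)\<^sup>2 / 2 \<le> (\<Sum>j=1..t. real j * ln (real j))"
proof (induction t)
  case (Suc t)
  show ?case
  proof (cases "t = 0")
    case False
    define u v where "u = ln (real t)" and "v = ln (real (Suc t))"
    have "ln (real (Suc t) / real t) \<le> real (Suc t) / real t - 1"
      using False by (intro ln_le_minus_one) auto
    then have "v - u \<le> 1 / real t" using False
      by (simp add: u_def v_def ln_div field_simps)
    then have "(real t)\<^sup>2 / 2 * (v - u) \<le> (real t)\<^sup>2 / 2 * (1 / real t)"
      by (intro mult_left_mono) auto
    then have *: "(real t)\<^sup>2 / 2 * (v - u) \<le> real t / 2"
      using False by (simp add: power2_eq_square)
    have "v \<ge> 0" by (simp add: v_def)
    have "(real (Suc t))\<^sup>2 / 2 * v - (real (Suc t))\<^sup>2 / 2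
        = ((real t)\<^sup>2 / 2 * u - (real t)\<^sup>2 / 2) + real (Suc t) * v
          + (real t)\<^sup>2 / 2 * (v - u) - v / 2 - real t - 1/2"
      by (simp add: field_simps power2_eq_square)
    also have "\<dots> \<le> (\<Sum>j=1..t. real j * ln (real j)) + real (Suc t) * v"
      using Suc * \<open>v \<ge> 0\<close> unfolding u_def by linarith
    finally show ?thesis by (simp add: v_def)
  qed simp
qed simp

lemma sum_sum_lessThan_eq:
  fixes d :: "nat \<Rightarrow> real" and c :: "nat \<Rightarrow> real"
  assumes "finite J" "\<And>j. j \<in> J \<Longrightarrow> \<alpha> j \<le> N"
  shows "(\<Sum>j\<in>J. \<Sum>i<\<alpha> j. c j * d i) = (\<Sum>i<N. d i * (\<Sum>j | j \<in> J \<and> i < \<alpha> j. c j))"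
proof -
  have "(\<Sum>j\<in>J. \<Sum>i<\<alpha> j. c j * d i) = (\<Sum>j\<in>J. \<Sum>i<N. if i < \<alpha> j then c j * d i else 0)"
  proof (rule sum.cong[OF refl])
    fix j assume "j \<in> J"
    then have "{i \<in> {..<N}. i < \<alpha> j} = {..<\<alpha> j}" using assms(2)[of j] by auto
    then show "(\<Sum>i<\<alpha> j. c j * d i) = (\<Sum>i<N. if i < \<alpha> j then c j * d i else 0)"
      by (subst sum.inter_filter[symmetric]) auto
  qed
  also have "\<dots> = (\<Sum>i<N. \<Sum>j\<in>J. if i < \<alpha> j then c j * d i else 0)" by (rule sum.swap)
  also have "\<dots> = (\<Sum>i<N. d i * (\<Sum>j | j \<in> J \<and> i < \<alpha> j. c j))"
    using assms(1) by (simp add: sum.inter_filter[symmetric] sum_distrib_left mult.commute)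
  finally show ?thesis .
qed

lemma layer_cake_bound:
  fixes h d :: "nat \<Rightarrow> real" and \<alpha> :: "nat \<Rightarrow> nat"
  assumes J: "finite J" "J \<subseteq> {1..}"
    and h: "mono_on {1..} h" "\<And>j. 1 \<le> j \<Longrightarrow> 1 \<le> h j"
    and hsum: "\<And>t. a * (real t)\<^sup>2 * ln (real t) - K * (real t)\<^sup>2 \<le> (\<Sum>j=1..t. h j)"
    and d: "\<And>i. 0 \<le> d i" "summable (\<lambda>i. (d i)\<^sup>2)"
    and a: "a > 0" and T: "T > 0" "a * ln T > K"
    and cost: "(\<Sum>j\<in>J. real (\<alpha> j) * h j) \<le> Z"
  shows "(\<Sum>j\<in>J. \<Sum>i<\<alpha> j. d i)
           \<le> T * (\<Sum>i<nat \<lfloor>Z\<rfloor>. d i) + sqrt ((\<Sum>i. (d i)\<^sup>2) * (Z / (a * ln T - K)))"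
proof -
  define N where "N = nat \<lfloor>Z\<rfloor>"
  define S where "S i = {j. j \<in> J \<and> i < \<alpha> j}" for i
  define t where "t i = card (S i)" for i
  define I where "I = {i \<in> {..<N}. real (t i) > T}"
  have finS: "finite (S i)" "S i \<subseteq> {1..}" for i using J by (auto simp: S_def)
  have h_nonneg: "0 \<le> h j" if "j \<in> J" for j
    using h(2)[of j] J(2) that by fastforce
  have le_N: "\<alpha> j \<le> N" if "j \<in> J" for j
  proof -
    have "real (\<alpha> j) * 1 \<le> real (\<alpha> j) * h j" using h(2) J that by (intro mult_left_mono) auto
    also have "\<dots> \<le> (\<Sum>j\<in>J. real (\<alpha> j) * h j)"
      using J h_nonneg that by (intro member_le_sum) auto
    finally have "real (\<alpha> j) \<le> Z" using cost by simp
    then show ?thesis unfolding N_def by linarith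
  qed
  have hsum_nonneg: "0 \<le> (\<Sum>j=1..t. h j)" for t
    using h(2) order.trans[OF zero_le_one] by (intro sum_nonneg) auto
  have "(\<Sum>i\<in>I. (real (t i))\<^sup>2) * (a * ln T - K)
      = (\<Sum>i\<in>I. a * (real (t i))\<^sup>2 * ln T - K * (real (t i))\<^sup>2)"
    unfolding sum_distrib_right by (intro sum.cong) (auto simp: algebra_simps)
  also have "\<dots> \<le> (\<Sum>i\<in>I. \<Sum>j=1..t i. h j)"
  proof (rule sum_mono)
    fix i assume "i \<in> I"
    then have "ln T \<le> ln (real (t i))" using T by (simp add: I_def)
    then have "a * (real (t i))\<^sup>2 * ln T \<le> a * (real (t i))\<^sup>2 * ln (real (t i))"
      using a by (intro mult_left_mono) auto
    then show "a * (real (t i))\<^sup>2 * ln T - K * (real (t i))\<^sup>2 \<le> (\<Sum>j=1..t i. h j)"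
      using hsum[of "t i"] by linarith
  qed
  also have "\<dots> \<le> (\<Sum>i<N. \<Sum>j=1..t i. h j)"
    using hsum_nonneg by (intro sum_mono2) (auto simp: I_def)
  also have "\<dots> \<le> (\<Sum>i<N. \<Sum>j\<in>S i. h j)"
    unfolding t_def using finS h(1) by (intro sum_mono sum_le_sum_of_finite_subset)
  also have "\<dots> = (\<Sum>j\<in>J. real (\<alpha> j) * h j)"
    using sum_sum_lessThan_eq[OF J(1) le_N, where c = h and d = "\<lambda>_. 1"]
    by (simp add: S_def mult.commute)
  finally have t_sq: "(\<Sum>i\<in>I. (real (t i))\<^sup>2) \<le> Z / (a * ln T - K)"
    using cost T by (simp add: pos_le_divide_eq)
  have "(\<Sum>j\<in>J. \<Sum>i<\<alpha> j. d i) = (\<Sum>i<N. d i * real (t i))"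
    using sum_sum_lessThan_eq[OF J(1) le_N, where c = "\<lambda>_. 1" and d = d] by (simp add: S_def t_def)
  also have "\<dots> \<le> (\<Sum>i<N. T * d i + (if real (t i) > T then d i * real (t i) else 0))"
  proof (rule sum_mono)
    fix i
    have "d i * real (t i) \<le> d i * T" if "real (t i) \<le> T" using that d by (intro mult_left_mono)
    then show "d i * real (t i) \<le> T * d i + (if real (t i) > T then d i * real (t i) else 0)"
      using d(1)[of i] T by (auto simp: mult.commute not_less)
  qed
  also have "\<dots> = T * (\<Sum>i<N. d i) + (\<Sum>i\<in>I. d i * real (t i))"
    by (simp add: sum.distrib sum_distrib_left I_def sum.inter_filter[symmetric])
  also have "(\<Sum>i\<in>I. d i * real (t i)) \<le> sqrt ((\<Sum>i. (d i)\<^sup>2) * (Z / (a * ln T - K)))"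
  proof (rule real_le_rsqrt)
    have "(\<Sum>i\<in>I. d i * real (t i))\<^sup>2 \<le> (\<Sum>i\<in>I. (d i)\<^sup>2) * (\<Sum>i\<in>I. (real (t i))\<^sup>2)"
      by (rule Cauchy_Schwarz_ineq_sum)
    also have "\<dots> \<le> (\<Sum>i. (d i)\<^sup>2) * (Z / (a * ln T - K))"
      using t_sq d by (intro mult_mono sum_le_suminf sum_nonneg suminf_nonneg) (auto simp: I_def)
    finally show "(\<Sum>i\<in>I. d i * real (t i))\<^sup>2 \<le> (\<Sum>i. (d i)\<^sup>2) * (Z / (a * ln T - K))" .
  qed
  finally show ?thesis by (simp add: N_def)
qed

lemma sum_multiplicity_ln_le:
  fixes k :: nat
  assumes "k > 0" "finite R" "\<And>r. r \<in> R \<Longrightarrow> prime r"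
  shows "(\<Sum>r\<in>R. real (multiplicity r k) * ln (real r)) \<le> ln (real k)"
proof -
  have pos: "real (p ^ multiplicity p k) > 0" if "p \<in> prime_factors k" for p
    using that by (simp add: in_prime_factors_imp_prime prime_gt_0_nat)
  have "(\<Sum>r\<in>R. real (multiplicity r k) * ln (real r))
      = (\<Sum>r\<in>R \<inter> prime_factors k. real (multiplicity r k) * ln (real r))"
    using assms by (intro sum.mono_neutral_right) (auto simp: prime_factors_multiplicity)
  also have "\<dots> \<le> (\<Sum>r\<in>prime_factors k. real (multiplicity r k) * ln (real r))"
    by (intro sum_mono2) (auto intro!: mult_nonneg_nonneg ln_ge_zero
        dest!: in_prime_factors_imp_prime prime_ge_1_nat)
  also have "\<dots> = (\<Sum>p\<in>prime_factors k. ln (real (p ^ multiplicity p k)))"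
    by (intro sum.cong) (auto simp: ln_realpow in_prime_factors_imp_prime prime_gt_0_nat)
  also have "\<dots> = ln (\<Prod>p\<in>prime_factors k. real (p ^ multiplicity p k))"
    using pos by (intro ln_prod[symmetric]) auto
  also have "(\<Prod>p\<in>prime_factors k. real (p ^ multiplicity p k)) = real k"
    using prime_factorization_nat[of k] assms(1) by (metis of_nat_prod)
  finally show ?thesis .
qed

lemma sum_mset_image_mset_eq_sum_count:
  fixes H :: "'a \<Rightarrow> nat"
  shows "(\<Sum>r\<in>#M. H r) = (\<Sum>r\<in>set_mset M. count M r * H r)"
proof (induction M)
  case (add x M)
  have "(\<Sum>r\<in>set_mset (add_mset x M). count (add_mset x M) r * H r)
      = (\<Sum>r\<in>set_mset (add_mset x M). count M r * H r + (if r = x then H x else 0))"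
    by (intro sum.cong) auto
  also have "\<dots> = (\<Sum>r\<in>set_mset (add_mset x M). count M r * H r) + H x"
    by (simp add: sum.distrib sum.delta)
  also have "(\<Sum>r\<in>set_mset (add_mset x M). count M r * H r) = (\<Sum>r\<in>set_mset M. count M r * H r)"
    by (intro sum.mono_neutral_right) (auto simp: not_in_iff)
  finally show ?case using add by simp
qed simp

lemma sum_multiplicity_dagger_le:
  assumes super: "\<And>a b. a \<in> mult_monoid Q \<Longrightarrow> b \<in> mult_monoid Q \<Longrightarrow> a \<noteq> 1 \<Longrightarrow> b \<noteq> 1 \<Longrightarrow>
      the_enat (dagger g a) + the_enat (dagger g b) \<le> the_enat (dagger g (a * b))"
    and primes: "\<And>r. r \<in> Q \<Longrightarrow> prime r"
    and g: "mono g" "mult_monoid Q \<subseteq> g ` {1..}" "1 \<le> g \<nu>"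
    and R: "finite R" "R \<subseteq> Q" and "1 \<le> \<nu>"
  shows "(\<Sum>r\<in>R. multiplicity r (g \<nu>) * the_enat (dagger g r)) \<le> \<nu>"
proof -
  let ?H = "\<lambda>y. the_enat (dagger g y)"
  define M where "M = filter_mset (\<lambda>r. r \<in> R) (prime_factorization (g \<nu>))"
  have M: "set_mset M \<subseteq> Q" using R by (auto simp: M_def)
  have "prod_mset M dvd prod_mset (prime_factorization (g \<nu>))"
    unfolding M_def by (intro prod_mset_subset_imp_dvd) auto
  then have "prod_mset M dvd g \<nu>" using g(3) by (simp add: prod_mset_prime_factorization_nat)
  then have le: "prod_mset M \<le> g \<nu>" using g(3) by (intro dvd_imp_le) auto
  have "(\<Sum>r\<in>R. multiplicity r (g \<nu>) * ?H r) = (\<Sum>r\<in>R. count M r * ?H r)"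
    using R primes by (intro sum.cong) (auto simp: M_def count_prime_factorization_prime)
  also have "\<dots> = (\<Sum>r\<in>set_mset M. count M r * ?H r)"
    using R by (intro sum.mono_neutral_right) (auto simp: M_def not_in_iff)
  also have "\<dots> = (\<Sum>r\<in>#M. ?H r)"
    by (simp add: sum_mset_image_mset_eq_sum_count)
  also have "\<dots> \<le> ?H (prod_mset M)"
    by (rule sum_image_mset_le_superadditive[OF super primes M])
  also have "\<dots> \<le> \<nu>"
    using M g le \<open>1 \<le> \<nu>\<close> by (intro the_enat_dagger_le) (auto simp: mult_monoid_def)
  finally show ?thesis .
qed

text \<open>
  Primes \<open>p \<le> T\<close> of \<open>n\<close> contribute at most \<open>T * B / ln 2\<close> prime factors to \<open>f n\<close>, each of which
  raises \<open>ln (f (f n))\<close> by at most \<open>D\<close>; the exponents \<open>\<alpha>\<close> come from the primes \<open>p > T\<close> only, for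
  which \<open>ln p\<close> may be replaced by \<open>ln T\<close>.
\<close>
lemma ln_iterate_le:
  fixes f g q :: "nat \<Rightarrow> nat" and n :: nat and L B D T :: real
  defines "d \<equiv> \<lambda>i. ln (real (g (Suc i)) / real (g i))"
  assumes q: "inj_on q {1..}" "Q = q ` {1..}"
    and primes: "\<And>r. r \<in> Q \<Longrightarrow> prime r"
    and super: "\<And>a b. a \<in> mult_monoid Q \<Longrightarrow> b \<in> mult_monoid Q \<Longrightarrow> a \<noteq> 1 \<Longrightarrow> b \<noteq> 1 \<Longrightarrow>
      the_enat (dagger g a) + the_enat (dagger g b) \<le> the_enat (dagger g (a * b))"
    and g: "mono g" "mult_monoid Q \<subseteq> g ` {1..}" "\<And>x. 1 \<le> g x" "g 0 = 1"
    and f: "multiplicative f"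
      "\<And>p \<nu>. prime p \<Longrightarrow> p \<in> Q \<Longrightarrow> 1 \<le> \<nu> \<Longrightarrow> f (p ^ \<nu>) = g \<nu>"
      "\<And>p \<nu>. prime p \<Longrightarrow> p \<notin> Q \<Longrightarrow> 1 \<le> \<nu> \<Longrightarrow> f (p ^ \<nu>) \<in> {0, 1}"
    and n: "n > 0" "f n > 0" "f (f n) > 0" "ln (real n) \<le> L"
    and T: "T > 1"
    and D: "\<And>i. d i \<le> D" "0 \<le> D"
    and B: "\<And>\<nu>. 1 \<le> \<nu> \<Longrightarrow> real \<nu> * ln 2 \<le> L \<Longrightarrow> ln (real (g \<nu>)) \<le> B" "0 \<le> B"
  obtains J \<alpha> where "finite J" "J \<subseteq> {1..}"
    "(\<Sum>j\<in>J. real (\<alpha> j) * real (the_enat (dagger g (q j)))) \<le> L / ln T"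
    "ln (real (f (f n))) \<le> (\<Sum>j\<in>J. \<Sum>i<\<alpha> j. d i) + D * (T * (B / ln 2))"
proof -
  let ?H = "\<lambda>y. the_enat (dagger g y)"
  have g_pos: "0 < g x" for x using g(3)[of x] by simp
  have f_eq: "f k = (\<Prod>p\<in>prime_factors k \<inter> Q. g (multiplicity p k))" if k: "k > 0" "f k > 0" for k
  proof -
    have *: "f k = (\<Prod>p\<in>prime_factors k. f (p ^ multiplicity p k))"
      by (rule multiplicative_eq_prod) fact+
    then have nz: "f (p ^ multiplicity p k) \<noteq> 0" if "p \<in> prime_factors k" for p
      using that k by (metis finite_set_mset less_irrefl prod_zero)
    have mult: "prime p" "1 \<le> multiplicity p k" if "p \<in> prime_factors k" for p
      using that by (auto simp: prime_factors_multiplicity)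
    have "(\<Prod>p\<in>prime_factors k. f (p ^ multiplicity p k))
        = (\<Prod>p\<in>prime_factors k \<inter> Q. f (p ^ multiplicity p k))"
    proof (intro prod.mono_neutral_right ballI)
      fix p assume "p \<in> prime_factors k - prime_factors k \<inter> Q"
      then show "f (p ^ multiplicity p k) = 1"
        using f(3)[of p "multiplicity p k"] nz[of p] mult[of p] by auto
    qed auto
    also have "\<dots> = (\<Prod>p\<in>prime_factors k \<inter> Q. g (multiplicity p k))"
      using f(2) mult by (intro prod.cong) auto
    finally show ?thesis using * by simp
  qed
  have ln_g: "ln (real (g k)) = (\<Sum>i<k. d i)" for k
    using g_pos g(4) by (induction k) (auto simp: d_def ln_div)
  define m \<nu> where "m = f n" and "\<nu> p = multiplicity p n" for p
  define P where "P = prime_factors n \<inter> Q"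
  define R where "R = prime_factors m \<inter> Q"
  define P1 where "P1 = {p \<in> P. real p \<le> T}"
  define P2 where "P2 = {p \<in> P. real p > T}"
  define u where "u r = (\<Sum>p\<in>P1. multiplicity r (g (\<nu> p)))" for r
  define w where "w r = (\<Sum>p\<in>P2. multiplicity r (g (\<nu> p)))" for r
  have fin: "finite P" "finite P1" "finite P2" "finite R" by (auto simp: P_def P1_def P2_def R_def)
  have P: "prime p" "1 \<le> \<nu> p" if "p \<in> P" for p
    using that by (auto simp: P_def \<nu>_def prime_factors_multiplicity)
  have R: "R \<subseteq> Q" "\<And>r. r \<in> R \<Longrightarrow> prime r" using primes by (auto simp: R_def)
  have "m > 0" using n by (simp add: m_def)
  have m: "m = (\<Prod>p\<in>P. g (\<nu> p))" unfolding m_def P_def \<nu>_def using n by (intro f_eq)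
  have mult_m: "multiplicity r m = w r + u r" if "r \<in> R" for r
  proof -
    have "multiplicity r m = (\<Sum>p\<in>P. multiplicity r (g (\<nu> p)))"
      unfolding m using R(2)[OF that] fin g_pos
      by (intro prime_elem_multiplicity_prod_distrib) (auto simp: image_iff dest: gr_implies_not0)
    also have "P = P2 \<union> P1" by (auto simp: P1_def P2_def)
    also have "(\<Sum>p\<in>P2 \<union> P1. multiplicity r (g (\<nu> p))) = w r + u r"
      unfolding w_def u_def using fin by (intro sum.union_disjoint) (auto simp: P1_def P2_def)
    finally show ?thesis .
  qed
  have ln_n: "(\<Sum>p\<in>P'. real (\<nu> p) * ln (real p)) \<le> L" if "P' \<subseteq> P" for P'
    unfolding \<nu>_def using that P n fin(1)
    by (intro order.trans[OF sum_multiplicity_ln_le]) (auto intro: finite_subset)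
  have u_le: "real (\<Sum>r\<in>R. u r) \<le> T * (B / ln 2)"
  proof -
    have g_le: "real (\<Sum>r\<in>R. multiplicity r (g (\<nu> p))) \<le> B / ln 2" if p: "p \<in> P1" for p
    proof -
      have "real (\<nu> p) * ln 2 \<le> real (\<nu> p) * ln (real p)"
        using P(1)[of p] p prime_ge_2_nat[of p] by (intro mult_left_mono) (auto simp: P1_def)
      also have "\<dots> \<le> L" using ln_n[of "{p}"] p by (simp add: P1_def)
      finally have ln_le: "ln (real (g (\<nu> p))) \<le> B" using p P(2) by (intro B) (auto simp: P1_def)
      have "real (\<Sum>r\<in>R. multiplicity r (g (\<nu> p))) * ln 2
          = (\<Sum>r\<in>R. real (multiplicity r (g (\<nu> p))) * ln 2)"
        by (simp add: sum_distrib_right)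
      also have "\<dots> \<le> (\<Sum>r\<in>R. real (multiplicity r (g (\<nu> p))) * ln (real r))"
      proof (intro sum_mono mult_left_mono)
        fix r assume "r \<in> R"
        then show "ln 2 \<le> ln (real r)" using R(2) prime_ge_2_nat[of r] by simp
      qed auto
      also have "\<dots> \<le> ln (real (g (\<nu> p)))"
        using g_pos fin R by (intro sum_multiplicity_ln_le)
      finally show ?thesis using ln_le by (simp add: pos_le_divide_eq)
    qed
    have "P1 \<subseteq> {1..nat \<lfloor>T\<rfloor>}"
      using P(1) prime_ge_1_nat by (auto simp: P1_def le_nat_floor)
    then have "card P1 \<le> nat \<lfloor>T\<rfloor>" using card_mono[of "{1..nat \<lfloor>T\<rfloor>}" P1] by simp
    then have card: "real (card P1) \<le> T" using T by linarith
    have "(\<Sum>r\<in>R. u r) = (\<Sum>p\<in>P1. \<Sum>r\<in>R. multiplicity r (g (\<nu> p)))"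
      unfolding u_def by (rule sum.swap)
    then have "real (\<Sum>r\<in>R. u r) = (\<Sum>p\<in>P1. real (\<Sum>r\<in>R. multiplicity r (g (\<nu> p))))"
      by (simp only: of_nat_sum)
    also have "\<dots> \<le> real (card P1) * (B / ln 2)" using g_le by (rule sum_bounded_above)
    also have "\<dots> \<le> T * (B / ln 2)" using card B by (intro mult_right_mono) auto
    finally show ?thesis .
  qed
  have cost: "(\<Sum>r\<in>R. real (w r) * real (?H r)) \<le> L / ln T"
  proof -
    have "(\<Sum>r\<in>R. w r * ?H r) = (\<Sum>p\<in>P2. \<Sum>r\<in>R. multiplicity r (g (\<nu> p)) * ?H r)"
      unfolding w_def sum_distrib_right by (rule sum.swap)
    also have "\<dots> \<le> (\<Sum>p\<in>P2. \<nu> p)"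
      using super primes g fin R P(2)
      by (intro sum_mono sum_multiplicity_dagger_le[where Q = Q]) (auto simp: P2_def)
    finally have "real (\<Sum>r\<in>R. w r * ?H r) \<le> real (\<Sum>p\<in>P2. \<nu> p)" by (simp only: of_nat_le_iff)
    then have "(\<Sum>r\<in>R. real (w r) * real (?H r)) * ln T \<le> (\<Sum>p\<in>P2. real (\<nu> p)) * ln T"
      using T by (intro mult_right_mono) auto
    also have "\<dots> \<le> (\<Sum>p\<in>P2. real (\<nu> p) * ln (real p))"
      unfolding sum_distrib_right using T by (intro sum_mono mult_left_mono) (auto simp: P2_def)
    also have "\<dots> \<le> L" by (rule ln_n) (auto simp: P2_def)
    finally show ?thesis using T by (simp add: pos_le_divide_eq)
  qed
  have "f m = (\<Prod>r\<in>R. g (multiplicity r m))"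
    unfolding R_def using n \<open>m > 0\<close> by (intro f_eq) (auto simp: m_def)
  then have "ln (real (f m)) = (\<Sum>r\<in>R. ln (real (g (multiplicity r m))))"
    using g_pos fin by (simp add: ln_prod)
  also have "\<dots> = (\<Sum>r\<in>R. \<Sum>i<w r + u r. d i)" using mult_m by (simp add: ln_g)
  also have "\<dots> \<le> (\<Sum>r\<in>R. (\<Sum>i<w r. d i) + D * real (u r))"
  proof (rule sum_mono)
    fix r
    have "(\<Sum>i<w r + u r. d i) = (\<Sum>i<w r. d i) + (\<Sum>i\<in>{w r..<w r + u r}. d i)"
      by (simp add: lessThan_atLeast0 sum.atLeastLessThan_concat)
    also have "(\<Sum>i\<in>{w r..<w r + u r}. d i) \<le> real (card {w r..<w r + u r}) * D"
      using D by (intro sum_bounded_above)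
    finally show "(\<Sum>i<w r + u r. d i) \<le> (\<Sum>i<w r. d i) + D * real (u r)"
      by (simp add: mult.commute)
  qed
  also have "\<dots> = (\<Sum>r\<in>R. \<Sum>i<w r. d i) + D * real (\<Sum>r\<in>R. u r)"
    by (simp add: sum.distrib sum_distrib_left)
  also have "\<dots> \<le> (\<Sum>r\<in>R. \<Sum>i<w r. d i) + D * (T * (B / ln 2))"
    using u_le D by (intro add_left_mono mult_left_mono)
  finally have bound: "ln (real (f m)) \<le> (\<Sum>r\<in>R. \<Sum>i<w r. d i) + D * (T * (B / ln 2))" .
  obtain J where J: "J \<subseteq> {1..}" "finite J" "R = q ` J"
    using finite_subset_image[OF fin(4)] R(1) q(2) by metis
  then have "inj_on q J" using q(1) inj_on_subset by blast
  with that[of J "w \<circ> q"] J cost bound show thesis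
    by (simp add: sum.reindex m_def)
qed

lemma strict_mono_on_index_le:
  fixes q :: "nat \<Rightarrow> nat"
  assumes "strict_mono_on {1..} q" "1 \<le> q 1" "1 \<le> j"
  shows "j \<le> q j"
  using assms(3)
proof (induction j rule: dec_induct)
  case base
  show ?case by fact
next
  case (step j)
  then have "q j < q (Suc j)" using strict_mono_onD[OF assms(1), of j "Suc j"] by auto
  then show ?case using step by simp
qed

lemma dagger_prime_ge:
  fixes q g :: "nat \<Rightarrow> nat" and \<kappa> c :: real
  assumes q: "\<And>j. 1 \<le> j \<Longrightarrow> j \<le> q j" and Q: "Q = q ` {1..}"
    and A1: "\<kappa> > 0"
      "\<exists>e \<in> O(\<lambda>_. 1). \<forall>\<^sub>F j in sequentially.
         real (q j) = \<kappa> * real j * (ln (real j) + ln (ln (real j)) + e j)"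
    and A7: "c > 0"
      "(\<lambda>y. real (the_enat (dagger g y)) - c * real y)
         \<in> O[inf at_top (principal Q)](\<lambda>y. real y / ln (real y))"
  obtains K where "0 \<le> K"
    "\<And>j. 1 \<le> j \<Longrightarrow> c * \<kappa> * real j * ln (real j) - K * real j \<le> real (the_enat (dagger g (q j)))"
proof -
  obtain e where e: "e \<in> O(\<lambda>_. 1)"
    "\<forall>\<^sub>F j in sequentially. real (q j) = \<kappa> * real j * (ln (real j) + ln (ln (real j)) + e j)"
    using A1(2) by blast
  obtain F where F: "F > 0" "\<forall>\<^sub>F j in sequentially. norm (e j) \<le> F * norm (1::real)"
    using landau_o.bigE[OF e(1)] by blast
  obtain G where G: "G > 0"
    "\<forall>\<^sub>F y in inf at_top (principal Q). norm (real (the_enat (dagger g y)) - c * real y)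
       \<le> G * norm (real y / ln (real y))"
    using landau_o.bigE[OF A7(2)] by blast
  obtain Y where Y: "\<And>y. y \<ge> Y \<Longrightarrow> y \<in> Q \<Longrightarrow>
      norm (real (the_enat (dagger g y)) - c * real y) \<le> G * norm (real y / ln (real y))"
    using G(2) unfolding eventually_inf_principal eventually_at_top_linorder by blast
  obtain N where N: "\<And>j. j \<ge> N \<Longrightarrow>
      real (q j) = \<kappa> * real j * (ln (real j) + ln (ln (real j)) + e j) \<and> \<bar>e j\<bar> \<le> F"
    using eventually_conj[OF e(2) F(2)] unfolding eventually_sequentially by auto
  define M where "M = max (max N Y) 3"
  define K where "K = max (c * \<kappa> * ln (real M)) (c * \<kappa> * F + G * \<kappa> * (2 + F))"
  have K0: "0 \<le> K" unfolding K_def using A1 A7 F G by (auto intro!: max.coboundedI2)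
  have "c * \<kappa> * real j * ln (real j) - K * real j \<le> real (the_enat (dagger g (q j)))"
    if j: "1 \<le> j" for j
  proof (cases "j \<ge> M")
    case False
    have "c * \<kappa> * ln (real j) \<le> c * \<kappa> * ln (real M)"
      using False j A1 A7 by (intro mult_left_mono) auto
    also have "\<dots> \<le> K" by (simp add: K_def)
    finally have "real j * (c * \<kappa> * ln (real j)) \<le> real j * K" by (intro mult_left_mono) auto
    then have "c * \<kappa> * real j * ln (real j) - K * real j \<le> 0" by (simp add: algebra_simps)
    then show ?thesis by (rule order.trans) simp
  next
    case True
    then have j3: "j \<ge> 3" "j \<ge> N" "q j \<ge> Y" using q[of j] by (auto simp: M_def)
    define l where "l = ln (real j)"
    have l1: "1 \<le> l"
    proof -
      have "exp 1 \<le> real j" using exp_le j3(1) by linarith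
      then show ?thesis unfolding l_def using j3 by (subst ln_ge_iff) auto
    qed
    have lnl: "0 \<le> ln l" "ln l \<le> l" using l1 ln_le_minus_one[of l] by auto
    have qj: "real (q j) = \<kappa> * real j * (l + ln l + e j)" and ej: "\<bar>e j\<bar> \<le> F"
      using N[OF j3(2)] by (auto simp: l_def)
    have "q j \<ge> j" using q j by simp
    then have lnq: "l \<le> ln (real (q j))" unfolding l_def using j3 by simp
    have pos: "0 \<le> \<kappa> * real j" using A1 by simp
    have lower: "\<kappa> * real j * (l - F) \<le> real (q j)"
      unfolding qj using pos lnl ej by (intro mult_left_mono) auto
    have F_l: "F \<le> F * l" using F l1 by simp
    have q_le: "real (q j) \<le> \<kappa> * real j * ((2 + F) * l)"
      unfolding qj using pos lnl ej F_l by (intro mult_left_mono) (auto simp: algebra_simps)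
    have upper: "real (q j) / ln (real (q j)) \<le> \<kappa> * (2 + F) * real j"
    proof -
      have "real (q j) / ln (real (q j)) \<le> real (q j) / l"
        using lnq l1 by (intro divide_left_mono) (auto intro!: mult_pos_pos)
      also have "\<dots> \<le> \<kappa> * real j * ((2 + F) * l) / l" using q_le l1 by (intro divide_right_mono) auto
      also have "\<dots> = \<kappa> * (2 + F) * real j" using l1 by simp
      finally show ?thesis .
    qed
    have "\<bar>real (the_enat (dagger g (q j))) - c * real (q j)\<bar> \<le> G * (real (q j) / ln (real (q j)))"
      using Y[OF j3(3)] Q j lnq l1 by auto
    then have "real (the_enat (dagger g (q j))) \<ge> c * real (q j) - G * (real (q j) / ln (real (q j)))"
      by linarith
    moreover have "c * real (q j) \<ge> c * (\<kappa> * real j * (l - F))"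
      using lower A7 by (intro mult_left_mono) auto
    moreover have "G * (real (q j) / ln (real (q j))) \<le> G * (\<kappa> * (2 + F) * real j)"
      using upper G by (intro mult_left_mono) auto
    moreover have "(c * \<kappa> * F + G * \<kappa> * (2 + F)) * real j \<le> K * real j"
      by (intro mult_right_mono) (auto simp: K_def)
    ultimately show ?thesis unfolding l_def[symmetric] by (simp add: algebra_simps)
  qed
  with K0 show thesis by (rule that)
qed

lemma sum_ge_of_mult_ln_lower_bound:
  fixes h :: "nat \<Rightarrow> real"
  assumes "b \<ge> 0" "K \<ge> 0"
    and h: "\<And>j. 1 \<le> j \<Longrightarrow> b * real j * ln (real j) - K * real j \<le> h j"
  shows "b / 2 * (real t)\<^sup>2 * ln (real t) - (b / 2 + K) * (real t)\<^sup>2 \<le> (\<Sum>j=1..t. h j)"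
proof -
  have "(\<Sum>j=1..t. real j) \<le> (\<Sum>j=1..t. real t)" by (intro sum_mono) auto
  then have "(\<Sum>j=1..t. real j) \<le> (real t)\<^sup>2" by (simp add: power2_eq_square)
  then have 1: "K * (\<Sum>j=1..t. real j) \<le> K * (real t)\<^sup>2" using assms(2) by (rule mult_left_mono)
  have 2: "b * ((real t)\<^sup>2 / 2 * ln (real t) - (real t)\<^sup>2 / 2) \<le> b * (\<Sum>j=1..t. real j * ln (real j))"
    using sum_nat_mult_ln_ge assms(1) by (rule mult_left_mono)
  have "b * (\<Sum>j=1..t. real j * ln (real j)) - K * (\<Sum>j=1..t. real j)
      = (\<Sum>j=1..t. b * real j * ln (real j) - K * real j)"
    by (simp add: sum_distrib_left sum_subtractf mult.assoc)
  also have "\<dots> \<le> (\<Sum>j=1..t. h j)" using h by (intro sum_mono) auto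
  finally show ?thesis using 1 2 by (simp add: algebra_simps)
qed

lemma summable_ln_quotient_sq:
  fixes g :: "nat \<Rightarrow> nat"
  assumes g: "mono g" "\<And>x. 1 \<le> g x"
    and "\<epsilon> > 0" "(\<lambda>i. real (g i) / real (g (i - 1)) - 1) \<in> O(\<lambda>i. real i powr (- 1 / 2 - \<epsilon>))"
  shows "summable (\<lambda>i. (ln (real (g (Suc i)) / real (g i)))\<^sup>2)"
proof -
  have g_pos: "0 < g x" for x using g(2)[of x] by simp
  obtain c where c: "c > 0" "\<forall>\<^sub>F i in sequentially. norm (real (g i) / real (g (i - 1)) - 1)
      \<le> c * norm (real i powr (- 1 / 2 - \<epsilon>))"
    using landau_o.bigE[OF assms(4)] by blast
  have "\<forall>\<^sub>F i in sequentially. norm (real (g (Suc i)) / real (g i) - 1)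
      \<le> c * norm (real (Suc i) powr (- 1 / 2 - \<epsilon>))"
    using c(2) by (subst (asm) eventually_sequentially_Suc[symmetric]) simp
  then have "\<forall>\<^sub>F i in sequentially. norm ((ln (real (g (Suc i)) / real (g i)))\<^sup>2)
      \<le> c\<^sup>2 * real (Suc i) powr (- 1 - 2 * \<epsilon>)"
  proof eventually_elim
    case (elim i)
    have "g i \<le> g (Suc i)" using g(1) by (simp add: monoD)
    then have "1 \<le> real (g (Suc i)) / real (g i)" using g_pos by (simp add: le_divide_eq)
    then have "0 \<le> ln (real (g (Suc i)) / real (g i))"
      "ln (real (g (Suc i)) / real (g i)) \<le> c * real (Suc i) powr (- 1 / 2 - \<epsilon>)"
      using ln_le_minus_one[of "real (g (Suc i)) / real (g i)"] elim by auto
    then have "(ln (real (g (Suc i)) / real (g i)))\<^sup>2 \<le> (c * real (Suc i) powr (- 1 / 2 - \<epsilon>))\<^sup>2"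
      by (intro power_mono)
    also have "\<dots> = c\<^sup>2 * real (Suc i) powr (- 1 - 2 * \<epsilon>)"
      by (simp add: power_mult_distrib power2_eq_square powr_add[symmetric] del: of_nat_Suc)
    finally show ?case by simp
  qed
  moreover have "summable (\<lambda>i. c\<^sup>2 * real (Suc i) powr (- 1 - 2 * \<epsilon>))"
    using assms(3) by (intro summable_mult) (subst summable_Suc_iff, simp add: summable_real_powr_iff)
  ultimately show ?thesis by (rule summable_comparison_test_ev)
qed

lemma eventually_threshold_bound:
  fixes S a K D c :: real
  assumes "S \<ge> 0" "a > 0" "D \<ge> 0"
  defines "T \<equiv> \<lambda>L. sqrt L / ln L ^ 3"
  shows "\<forall>\<^sub>F L in at_top. ln (T L) > 1 \<and> a * ln (T L) > K \<and> 1 \<le> ln (ln L) \<and>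
     1 \<le> ln L \<and> c \<le> ln L \<and> 0 < L \<and>
     T L * (2 * ln L) + sqrt (S * (L / ln (T L) / (a * ln (T L) - K))) + D * (T L * (2 * ln L / ln 2))
       \<le> sqrt L / ln L * (sqrt (4 * S / a)
            + (16 * sqrt (4 * S / a) + 2 + 2 * D / ln 2) * (ln (ln L) / ln L))"
proof -
  have "\<forall>\<^sub>F L::real in at_top. (ln L)\<^sup>2 \<le> 4 * (ln L / 2 - 3 * ln (ln L)) * (ln L / 2 - 4 * ln (ln L))
      * (1 + 16 * ln (ln L) / ln L)\<^sup>2"
    by real_asymp
  moreover have "\<forall>\<^sub>F L::real in at_top. ln L / 2 - 4 * ln (ln L) > max 1 (K / a)" by real_asymp
  moreover have "\<forall>\<^sub>F L::real in at_top. ln (ln L) > max 1 (K / a)" by real_asymp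
  moreover have "\<forall>\<^sub>F L::real in at_top. ln L > max 1 c" by real_asymp
  moreover have "\<forall>\<^sub>F L::real in at_top. L > 0" by real_asymp
  ultimately show ?thesis
  proof eventually_elim
    case (elim L)
    define l where "l = ln L"
    define t where "t = ln (T L)"
    have l: "l > 1" "ln l > 1" "l > c" "ln l > K / a" using elim by (auto simp: l_def)
    have t: "t = l / 2 - 3 * ln l"
      using elim l by (simp add: t_def T_def l_def ln_div ln_sqrt ln_realpow)
    have t1: "t > 1" "t > K / a" "l / 2 - 4 * ln l > 1" using elim l t by (auto simp: l_def)
    have aK: "a * (l / 2 - 4 * ln l) \<le> a * t - K"
    proof -
      have "K \<le> a * ln l" using l assms(2) by (simp add: field_simps)
      then show ?thesis unfolding t by (simp add: algebra_simps)
    qed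
    have apos: "0 < a * (l / 2 - 4 * ln l)" using t1 assms by simp
    define w where "w = 1 + 16 * ln l / l"
    have w: "w > 0" using l by (simp add: w_def add_pos_pos)
    have "a * l\<^sup>2 \<le> a * (4 * t * (l / 2 - 4 * ln l) * w\<^sup>2)"
      using elim(1) assms unfolding t w_def l_def by (intro mult_left_mono) auto
    also have "\<dots> = 4 * w\<^sup>2 * t * (a * (l / 2 - 4 * ln l))" by (simp add: algebra_simps)
    also have "\<dots> \<le> 4 * w\<^sup>2 * t * (a * t - K)" using aK t1 by (intro mult_left_mono) auto
    finally have main: "a * l\<^sup>2 \<le> 4 * w\<^sup>2 * (t * (a * t - K))" by (simp add: mult.assoc)
    have tp: "0 < t * (a * t - K)" using t1 aK apos by (intro mult_pos_pos) auto
    have "S * (L / t / (a * t - K)) = S * L / (t * (a * t - K))" by simp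
    also have "\<dots> \<le> S * L * (4 * w\<^sup>2 / (a * l\<^sup>2))"
    proof -
      have "1 / (t * (a * t - K)) \<le> 4 * w\<^sup>2 / (a * l\<^sup>2)"
        using main tp assms(2) l by (simp add: divide_le_eq le_divide_eq field_simps)
      then have "S * L * (1 / (t * (a * t - K))) \<le> S * L * (4 * w\<^sup>2 / (a * l\<^sup>2))"
        using assms elim by (intro mult_left_mono) auto
      then show ?thesis by simp
    qed
    also have "\<dots> = (sqrt L / l * (sqrt (4 * S / a) * w))\<^sup>2"
      using assms elim(5) by (simp add: power_mult_distrib power_divide field_simps)
    finally have "sqrt (S * (L / t / (a * t - K))) \<le> sqrt L / l * (sqrt (4 * S / a) * w)"
      using l w assms elim by (intro real_le_lsqrt) auto
    moreover have "T L * (2 * l) + D * (T L * (2 * l / ln 2))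
        = (2 + 2 * D / ln 2) * (sqrt L / l * (1 / l))"
      using l by (simp add: T_def l_def[symmetric] field_simps power3_eq_cube)
    moreover have "\<dots> \<le> (2 + 2 * D / ln 2) * (sqrt L / l * (ln l / l))"
      using l assms elim by (intro mult_left_mono divide_right_mono) auto
    ultimately have "T L * (2 * l) + sqrt (S * (L / t / (a * t - K))) + D * (T L * (2 * l / ln 2))
       \<le> sqrt L / l * (sqrt (4 * S / a) * w) + (2 + 2 * D / ln 2) * (sqrt L / l * (ln l / l))"
      by linarith
    also have "\<dots> = sqrt L / l * (sqrt (4 * S / a)
            + (16 * sqrt (4 * S / a) + 2 + 2 * D / ln 2) * (ln l / l))"
      by (simp add: w_def algebra_simps)
    finally show ?case
      using t1 l elim aK apos unfolding t_def l_def by auto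
  qed
qed

lemma dagger_superadditive:
  fixes q :: "nat \<Rightarrow> nat" and c_star :: real
  assumes q: "\<And>j. 1 \<le> j \<Longrightarrow> prime (q j)" "strict_mono_on {1..} q" "Q = q ` {1..}"
    and A3: "mult_monoid Q \<subseteq> g ` {1..}"
    and A4: "c_star > 1 / real (q 1)"
      "\<forall>a \<in> mult_monoid Q. \<forall>b \<in> mult_monoid Q. q 1 \<le> a \<and> a \<le> b \<longrightarrow>
            ereal_of_enat (dagger g b) + ereal (c_star * real b) * ereal_of_enat (dagger g a)
              \<le> ereal_of_enat (dagger g (a * b))"
    and ab: "a \<in> mult_monoid Q" "b \<in> mult_monoid Q" "a \<noteq> 1" "b \<noteq> 1"
  shows "the_enat (dagger g a) + the_enat (dagger g b) \<le> the_enat (dagger g (a * b))"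
proof -
  have q1: "q 1 > 0" using prime_gt_0_nat[OF q(1)[OF order_refl]] .
  have q_min: "q 1 \<le> y" if y: "y \<in> mult_monoid Q" "y \<noteq> 1" for y
  proof -
    obtain M where M: "y = prod_mset M" "set_mset M \<subseteq> Q" using y by (auto simp: mult_monoid_def)
    with y have "M \<noteq> {#}" by auto
    then obtain r where r: "r \<in># M" by blast
    then obtain j where j: "1 \<le> j" "r = q j" using M(2) q(3) by auto
    have "q 1 \<le> q j" using strict_mono_on_leD[OF q(2), of 1 j] j by auto
    also have "q j \<le> y"
    proof (rule dvd_imp_le)
      show "q j dvd y" using r j M by (auto intro: dvd_prod_mset)
      have "prime s" if "s \<in># M" for s using that M(2) q(1,3) by auto
      then have "0 \<notin># M" using not_prime_0 by blast
      then show "0 < y" unfolding M(1) using prod_mset_zero_iff[of M] by (metis gr0I)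
    qed
    finally show ?thesis .
  qed
  have *: "the_enat (dagger g a) + the_enat (dagger g b) \<le> the_enat (dagger g (a * b))"
    if a: "a \<in> mult_monoid Q" "a \<noteq> 1" and b: "b \<in> mult_monoid Q" "b \<noteq> 1" and le: "a \<le> b" for a b
  proof -
    have "a * b \<in> mult_monoid Q"
    proof -
      obtain M N where "a = prod_mset M" "set_mset M \<subseteq> Q" "b = prod_mset N" "set_mset N \<subseteq> Q"
        using a b by (auto simp: mult_monoid_def)
      then show ?thesis unfolding mult_monoid_def by (intro CollectI exI[of _ "M + N"]) auto
    qed
    then have en: "dagger g y = enat (the_enat (dagger g y))" if "y \<in> {a, b, a * b}" for y
      using that a b A3 by (intro enat_the_enat_dagger[symmetric]) auto
    have "ereal_of_enat (dagger g b) + ereal (c_star * real b) * ereal_of_enat (dagger g a)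
              \<le> ereal_of_enat (dagger g (a * b))"
      using A4(2) a b le q_min[OF a] by blast
    then have real_le: "real (the_enat (dagger g b)) + c_star * real b * real (the_enat (dagger g a))
        \<le> real (the_enat (dagger g (a * b)))"
      using en[of a] en[of b] en[of "a * b"]
      by (metis ereal_less_eq(3) ereal_of_enat_simps(1) insertCI
          plus_ereal.simps(1) times_ereal.simps(1))
    have "1 \<le> c_star * real (q 1)" using A4(1) q1 by (simp add: divide_less_eq)
    also have "\<dots> \<le> c_star * real b"
      using q_min[OF b] A4(1) q1
      by (intro mult_left_mono) (auto intro: order.trans[of 0 "1 / real (q 1)"])
    finally have "1 * real (the_enat (dagger g a)) \<le> c_star * real b * real (the_enat (dagger g a))"
      by (intro mult_right_mono) auto
    with real_le show ?thesis by simp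
  qed
  show ?thesis
    using *[OF ab(1,3) ab(2,4)] *[OF ab(2,4) ab(1,3)] by (cases "a \<le> b") (auto simp: ac_simps)
qed

theorem theorem4p1:
  fixes q :: "nat \<Rightarrow> nat" and Q :: "nat set" and g f :: "nat \<Rightarrow> nat"
    and \<kappa> c_dag :: real
  assumes q_prime: "\<And>j. 1 \<le> j \<Longrightarrow> prime (q j)"
    and q_mono: "strict_mono_on {1..} q"
    and Q_eq: "Q = q ` {1..}"
    and g_pos: "\<And>x. 1 \<le> g x"
    and g_0: "g 0 = 1"
    and A1: "\<kappa> > 0"
      "\<exists>e \<in> O(\<lambda>_. 1). \<forall>\<^sub>F j in sequentially.
         real (q j) = \<kappa> * real j * (ln (real j) + ln (ln (real j)) + e j)"
    and A2: "mono g"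
    and A3: "mult_monoid Q \<subseteq> g ` {1..}"
    and A4: "\<exists>c_star :: real. c_star > 1 / real (q 1) \<and>
         (\<forall>a \<in> mult_monoid Q. \<forall>b \<in> mult_monoid Q. q 1 \<le> a \<and> a \<le> b \<longrightarrow>
            ereal_of_enat (dagger g b) + ereal (c_star * real b) * ereal_of_enat (dagger g a)
              \<le> ereal_of_enat (dagger g (a * b)))"
    and A5: "\<exists>\<epsilon> :: real. \<epsilon> > 0 \<and>
         (\<lambda>i. real (g i) / real (g (i - 1)) - 1) \<in> O(\<lambda>i. real i powr (- 1 / 2 - \<epsilon>))"
    and A6: "\<exists>c_f :: real. c_f > 0 \<and> (\<forall>x \<ge> 1. real (g x) \<le> c_f * real x)"
    and A7: "c_dag > 0"
      "(\<lambda>y. real (the_enat (dagger g y)) - c_dag * real y)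
         \<in> O[inf at_top (principal Q)](\<lambda>y. real y / ln (real y))"
    and f_mult: "multiplicative f"
    and f_0: "f 0 = 1"
    and f_Q: "\<And>p \<nu>. prime p \<Longrightarrow> p \<in> Q \<Longrightarrow> 1 \<le> \<nu> \<Longrightarrow> f (p ^ \<nu>) = g \<nu>"
    and f_not_Q: "\<And>p \<nu>. prime p \<Longrightarrow> p \<notin> Q \<Longrightarrow> 1 \<le> \<nu> \<Longrightarrow> f (p ^ \<nu>) \<in> {0, 1}"
  shows "\<exists>E :: real \<Rightarrow> real.
           E \<in> O(\<lambda>x. ln (ln (ln x)) / ln (ln x)) \<and>
           (\<forall>\<^sub>F x in at_top.
              max_log_iter f x
                \<le> ereal (sqrt (ln x) / ln (ln x) * (C_const g / sqrt (\<kappa> * c_dag) + E x)))"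
proof -
  define d where "d i = ln (real (g (Suc i)) / real (g i))" for i
  define S where "S = (\<Sum>i. (d i)\<^sup>2)"
  define h where "h j = real (the_enat (dagger g (q j)))" for j
  define D where "D = sqrt S"
  define a where "a = c_dag * \<kappa> / 2"
  define T where "T L = sqrt L / ln L ^ 3" for L :: real
  define C where "C = C_const g / sqrt (\<kappa> * c_dag)"
  obtain c_star where c_star: "c_star > 1 / real (q 1)"
    "\<forall>a \<in> mult_monoid Q. \<forall>b \<in> mult_monoid Q. q 1 \<le> a \<and> a \<le> b \<longrightarrow>
            ereal_of_enat (dagger g b) + ereal (c_star * real b) * ereal_of_enat (dagger g a)
              \<le> ereal_of_enat (dagger g (a * b))"
    using A4 by blast
  note super = dagger_superadditive[OF q_prime q_mono Q_eq A3 c_star]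
  obtain c_f where c_f: "c_f > 0" "\<And>x. x \<ge> 1 \<Longrightarrow> real (g x) \<le> c_f * real x" using A6 by blast
  obtain \<epsilon> where \<epsilon>: "\<epsilon> > 0"
    "(\<lambda>i. real (g i) / real (g (i - 1)) - 1) \<in> O(\<lambda>i. real i powr (- 1 / 2 - \<epsilon>))"
    using A5 by blast
  have g_gt_0: "0 < g x" for x using g_pos[of x] by simp
  have d_summable: "summable (\<lambda>i. (d i)\<^sup>2)"
    unfolding d_def using summable_ln_quotient_sq[OF A2 g_pos \<epsilon>] .
  have d_nonneg: "0 \<le> d i" for i
    unfolding d_def using monoD[OF A2, of i "Suc i"] g_gt_0[of i]
    by (intro ln_ge_zero) (simp add: le_divide_eq)
  have S_nonneg: "S \<ge> 0" unfolding S_def by (intro suminf_nonneg d_summable) auto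
  have d_le: "d i \<le> D" for i
    unfolding D_def S_def using sum_le_suminf[OF d_summable, of "{i}"] by (intro real_le_rsqrt) auto
  have sum_d: "(\<Sum>i<k. d i) = ln (real (g k))" for k
    using g_gt_0 g_0 by (induction k) (auto simp: d_def ln_div)
  have Q_primes: "prime r" if "r \<in> Q" for r using that q_prime Q_eq by auto
  have q_inj: "inj_on q {1..}" using q_mono by (rule strict_mono_on_imp_inj_on)
  have q_ge: "j \<le> q j" if "1 \<le> j" for j
    using strict_mono_on_index_le[OF q_mono prime_ge_1_nat[OF q_prime[of 1]] that] by simp
  have q_range: "q j \<in> g ` {1..}" if "1 \<le> j" for j
  proof -
    have "q j \<in> mult_monoid Q"
      unfolding mult_monoid_def using that Q_eq by (intro CollectI exI[of _ "{#q j#}"]) auto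
    then show ?thesis using A3 by blast
  qed
  have h_ge_1: "1 \<le> h j" if "1 \<le> j" for j
    using the_enat_dagger_ge_1[OF q_range[OF that]] by (simp add: h_def)
  have h_mono: "mono_on {1..} h"
  proof (rule mono_onI)
    fix i j :: nat assume ij: "i \<in> {1..}" "j \<in> {1..}" "i \<le> j"
    have "q i \<le> q j" using strict_mono_on_leD[OF q_mono ij] .
    then have "the_enat (dagger g (q i)) \<le> the_enat (dagger g (q j))"
      using ij q_range[of i] q_range[of j] apply_the_enat_dagger[of "q j" g]
        the_enat_dagger_ge_1[of "q j" g] by (intro the_enat_dagger_le[OF A2]) auto
    then show "h i \<le> h j" by (simp add: h_def)
  qed
  obtain K' where K': "0 \<le> K'" "\<And>j. 1 \<le> j \<Longrightarrow> c_dag * \<kappa> * real j * ln (real j) - K' * real j \<le> h j"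
    using dagger_prime_ge[OF q_ge Q_eq A1 A7] unfolding h_def by blast
  define K where "K = a + K'"
  have hsum: "a * (real t)\<^sup>2 * ln (real t) - K * (real t)\<^sup>2 \<le> (\<Sum>j=1..t. h j)" for t
    using sum_ge_of_mult_ln_lower_bound[OF _ K', of t] A1 A7 by (simp add: a_def K_def)
  have a_pos: "a > 0" using A1 A7 by (simp add: a_def)
  have C_eq: "C = sqrt (4 * S / a)"
    by (simp add: C_def C_const_def S_def d_def a_def real_sqrt_divide[symmetric] mult.commute)
  have D_nonneg: "0 \<le> D" using S_nonneg by (simp add: D_def)
  define E0 where "E0 = 16 * C + 2 + 2 * D / ln 2"
  define E where "E x = E0 * (ln (ln (ln x)) / ln (ln x))" for x :: real
  have C_nonneg: "0 \<le> C" using S_nonneg a_pos by (simp add: C_eq)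
  have E0_nonneg: "0 \<le> E0" using C_nonneg D_nonneg by (simp add: E0_def)
  have "\<forall>\<^sub>F x in at_top. (let L = ln x in ln (T L) > 1 \<and> a * ln (T L) > K \<and> 1 \<le> ln (ln L) \<and> 1 \<le> ln L \<and>
      \<bar>ln c_f\<bar> + \<bar>ln (c_f / ln 2)\<bar> \<le> ln L \<and> 0 < L \<and>
     T L * (2 * ln L) + sqrt (S * (L / ln (T L) / (a * ln (T L) - K))) + D * (T L * (2 * ln L / ln 2))
       \<le> sqrt L / ln L * (C + E0 * (ln (ln L) / ln L)))"
    unfolding Let_def
    using eventually_compose_filterlim[OF eventually_threshold_bound[OF S_nonneg a_pos D_nonneg,
        of K "\<bar>ln c_f\<bar> + \<bar>ln (c_f / ln 2)\<bar>"] ln_at_top]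
    unfolding C_eq E0_def T_def .
  then have "\<forall>\<^sub>F x in at_top. max_log_iter f x \<le> ereal (sqrt (ln x) / ln (ln x) * (C + E x))"
    using eventually_ge_at_top[of 1]
  proof eventually_elim
    case (elim x)
    define L where "L = ln x"
    let ?bound = "sqrt L / ln L * (C + E0 * (ln (ln L) / ln L))"
    have L: "ln (T L) > 1" "a * ln (T L) > K" "1 \<le> ln (ln L)" "1 \<le> ln L"
      "\<bar>ln c_f\<bar> + \<bar>ln (c_f / ln 2)\<bar> \<le> ln L" "0 < L"
      "T L * (2 * ln L) + sqrt (S * (L / ln (T L) / (a * ln (T L) - K))) + D * (T L * (2 * ln L / ln 2))
       \<le> ?bound"
      using elim(1) unfolding L_def Let_def by auto
    have T0: "T L > 0" unfolding T_def using L(4,6)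
      by (intro divide_pos_pos zero_less_power real_sqrt_gt_zero) linarith+
    then have T1: "T L > 1" using L(1) ln_gt_zero_iff[of "T L"] by linarith
    have bound_nonneg: "0 \<le> ?bound" using L(3,4,6) C_nonneg E0_nonneg
      by (intro mult_nonneg_nonneg add_nonneg_nonneg divide_nonneg_nonneg real_sqrt_ge_zero) linarith+
    have iter_le: "ln (real (f (f n))) \<le> ?bound"
      if n: "1 \<le> n" "real n \<le> x" and nz: "f n > 0" "f (f n) > 0" for n
    proof -
      have ln_n: "ln (real n) \<le> L" using n unfolding L_def by simp
      have g_le: "ln (real (g \<nu>)) \<le> 2 * ln L" if \<nu>: "1 \<le> \<nu>" "real \<nu> * ln 2 \<le> L" for \<nu>
      proof -
        have "real (g \<nu>) \<le> c_f * real \<nu>" using c_f \<nu> by simp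
        also have "\<dots> \<le> c_f * (L / ln 2)" using \<nu> c_f by (intro mult_left_mono) (auto simp: field_simps)
        finally have "ln (real (g \<nu>)) \<le> ln (c_f / ln 2 * L)" using g_gt_0[of \<nu>] by (simp add: ac_simps)
        also have "\<dots> = ln (c_f / ln 2) + ln L" using c_f L by (intro ln_mult_pos) auto
        finally show ?thesis using L by linarith
      qed
      obtain J \<alpha> where J: "finite J" "J \<subseteq> {1..}"
        and cost: "(\<Sum>j\<in>J. real (\<alpha> j) * h j) \<le> L / ln (T L)"
        and bd: "ln (real (f (f n))) \<le> (\<Sum>j\<in>J. \<Sum>i<\<alpha> j. d i) + D * (T L * (2 * ln L / ln 2))"
      proof (rule ln_iterate_le[where B = "2 * ln L" and D = D,
            OF q_inj Q_eq Q_primes super A2 A3 g_pos g_0 f_mult f_Q f_not_Q _ nz ln_n T1])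
        show "ln (real (g (Suc i)) / real (g i)) \<le> D" for i using d_le by (simp add: d_def)
        show "0 \<le> 2 * ln L" using L(4) by linarith
      qed (use n D_nonneg g_le in \<open>auto simp: h_def d_def\<close>)
      have N_le: "ln (real (g (nat \<lfloor>L / ln (T L)\<rfloor>))) \<le> 2 * ln L"
      proof (cases "nat \<lfloor>L / ln (T L)\<rfloor> \<ge> 1")
        case True
        let ?N = "nat \<lfloor>L / ln (T L)\<rfloor>"
        have "real ?N \<le> L / ln (T L)" using L by (intro of_nat_floor) auto
        also have "\<dots> \<le> L / 1" using L by (intro divide_left_mono) auto
        finally have N: "real ?N \<le> L" by simp
        have "real ?N * ln 2 \<le> real ?N * 1" using ln_2_less_1 by (intro mult_left_mono) auto
        then show ?thesis using N True by (intro g_le) auto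
      next
        case False
        then have "nat \<lfloor>L / ln (T L)\<rfloor> = 0" by linarith
        then have "g (nat \<lfloor>L / ln (T L)\<rfloor>) = 1" using g_0 by (simp only:)
        then have "ln (real (g (nat \<lfloor>L / ln (T L)\<rfloor>))) = 0" by simp
        then show ?thesis using L(4) by linarith
      qed
      have "(\<Sum>j\<in>J. \<Sum>i<\<alpha> j. d i) \<le> T L * (\<Sum>i<nat \<lfloor>L / ln (T L)\<rfloor>. d i)
          + sqrt (S * (L / ln (T L) / (a * ln (T L) - K)))"
        unfolding S_def
        by (rule layer_cake_bound[OF J h_mono h_ge_1 hsum d_nonneg d_summable a_pos T0 L(2) cost])
      also have "T L * (\<Sum>i<nat \<lfloor>L / ln (T L)\<rfloor>. d i) \<le> T L * (2 * ln L)"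
        unfolding sum_d using N_le T0 by (intro mult_left_mono) auto
      finally show ?thesis using bd L(7) by linarith
    qed
    have "elog (f (f n)) \<le> ereal ?bound" if n: "1 \<le> n" "real n \<le> x" for n
    proof (cases "f n = 0 \<or> f (f n) = 0")
      case True
      then show ?thesis using bound_nonneg f_0 by (auto simp: elog_def)
    next
      case False
      then show ?thesis using iter_le[OF n] by (simp add: elog_def)
    qed
    moreover have "finite {n. 1 \<le> n \<and> real n \<le> x}"
      by (rule finite_subset[of _ "{..nat \<lfloor>x\<rfloor>}"]) (auto simp: le_nat_floor)
    moreover have "1 \<in> {n. 1 \<le> n \<and> real n \<le> x}" using elim(2) by simp
    ultimately have "max_log_iter f x \<le> ereal ?bound"
      unfolding max_log_iter_def by (subst Max_le_iff) blast+
    then show ?case by (simp add: E_def L_def)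
  qed
  moreover have "E \<in> O(\<lambda>x. ln (ln (ln x)) / ln (ln x))"
    unfolding E_def
    by (intro bigoI[where c = "\<bar>E0\<bar>"] always_eventually allI) (simp add: abs_mult)
  ultimately show ?thesis unfolding C_def by blast
qed

end
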